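(* Let $\mathcal{A}$ be a Boolean tensor of size $I_1\times\cdots\times I_M\times J_1\times\cdots\times J_N$ and $\mathcal{X}$ a Boolean tensor of size $J_1\times\cdots\times J_N\times I_1\times\cdots\times I_M$. Then the following are equivalent: (a) $\mathcal{A}*_N\mathcal{X}*_M\mathcal{A}=\mathcal{A}$. (b) $\mathcal{X}*_M\mathcal{Y}$ is a solution of the tensor equation $\mathcal{A}*_N\mathcal{Z}=\mathcal{Y}$ (in the unknown $\mathcal{Z}$) whenever $\mathcal{Y}\in\mathfrak{R}(\mathcal{A})$. (c) $\mathcal{A}*_N\mathcal{X}$ is idempotent and $\mathfrak{R}(\mathcal{A})=\mathfrak{R}(\mathcal{A}*_N\mathcal{X})$. (d) $\mathcal{X}*_M\mathcal{A}$ is idempotent and $\mathfrak{R}(\mathcal{A}^T)=\mathfrak{R}(\mathcal{A}^T*_M\mathcal{X}^T)$.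
   Context: A Boolean tensor is an array with entries in $\{0,1\}$; entries are added and multiplied by the rules of the binary Boolean algebra ($1+1=1$, otherwise as usual). For $\mathcal{A}$ of size $I_1\times\cdots\times I_M\times J_1\times\cdots\times J_N$ and $\mathcal{B}$ of size $J_1\times\cdots\times J_N\times K_1\times\cdots\times K_L$, the Einstein product $\mathcal{A}*_N\mathcal{B}$ has entries $\sum_{j_1,\dots,j_N}a_{i_1\ldots i_Mj_1\ldots j_N}b_{j_1\ldots j_Nk_1\ldots k_L}$ (Boolean sum); the $k$-indices may be absent (a "vector" $\mathcal{B}$ of size $J_1\times\cdots\times J_N$). The subscript of $*$ is the number of contracted indices. The transpose is $(\mathcal{A}^T)_{j_1\ldots j_Ni_1\ldots i_M}=a_{i_1\ldots i_Mj_1\ldots j_N}$. The range is $\mathfrak{R}(\mathcal{A})=\{\mathcal{A}*_N\mathcal{X}:\mathcal{X}\text{ a Boolean tensor of size }J_1\times\cdots\times J_N\}$. A tensor $\mathcal{B}$ of size $I_1\times\cdots\times I_M\times I_1\times\cdots\times I_M$ is idempotent if $\mathcal{B}*_M\mathcal{B}=\mathcal{B}$. *)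

theory Defs
  imports Main
begin

text \<open>
  A size is a list of dimensions; multi-indices are lists of the same length, numbered from 0.
  The entries of the binary Boolean algebra are the values of type \<^typ>\<open>bool\<close>, with disjunction as
  sum and conjunction as product.
\<close>

definition multi_indices :: "nat list \<Rightarrow> nat list set" where
  "multi_indices ds = {is. list_all2 (<) is ds}"

text \<open>
  Entries outside the index range are fixed to 0, so that equality of tensors means equal size and
  equal entries (see \<open>bool_tensor_eqI\<close>).
\<close>

typedef bool_tensor = "{(ds :: nat list, f :: nat list \<Rightarrow> bool). \<forall>is. f is \<longrightarrow> is \<in> multi_indices ds}"
  by (rule exI[of _ "([], \<lambda>_. False)"]) simp

definition dims :: "bool_tensor \<Rightarrow> nat list" where
  "dims A = fst (Rep_bool_tensor A)"

definition entry :: "bool_tensor \<Rightarrow> nat list \<Rightarrow> bool" where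
  "entry A = snd (Rep_bool_tensor A)"

definition mk_tensor :: "nat list \<Rightarrow> (nat list \<Rightarrow> bool) \<Rightarrow> bool_tensor" where
  "mk_tensor ds f = Abs_bool_tensor (ds, \<lambda>is. is \<in> multi_indices ds \<and> f is)"

text \<open>
  Since the size of a tensor is one flat list, the grouping of its indices into rows and columns is
  recovered from the number of contracted indices: in \<open>A \<star>\<^bsub>N\<^esub> B\<close> the last \<open>N\<close> indices of \<open>A\<close> are
  contracted with the first \<open>N\<close> indices of \<open>B\<close>. The definition is meaningful only if the
  corresponding dimensions agree.
\<close>

definition einstein_product :: "bool_tensor \<Rightarrow> nat \<Rightarrow> bool_tensor \<Rightarrow> bool_tensor"
    ("(_ \<star>\<^bsub>_\<^esub> _)" [70, 0, 71] 70) where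
  "A \<star>\<^bsub>N\<^esub> B =
    (let M = length (dims A) - N in
      mk_tensor (take M (dims A) @ drop N (dims B))
        (\<lambda>is. \<exists>j \<in> multi_indices (drop M (dims A)).
                 entry A (take M is @ j) \<and> entry B (j @ drop M is)))"

text \<open>
  In \<open>tensor_transpose M A\<close>, the first \<open>M\<close> indices of \<open>A\<close> are its row indices; in
  \<open>tensor_range N A\<close> and \<open>is_solution N A Y Z\<close>, the last \<open>N\<close> indices of \<open>A\<close> are its column indices.
\<close>

definition tensor_transpose :: "nat \<Rightarrow> bool_tensor \<Rightarrow> bool_tensor" where
  "tensor_transpose M A =
    (let N = length (dims A) - M in
      mk_tensor (drop M (dims A) @ take M (dims A)) (\<lambda>is. entry A (drop N is @ take N is)))"

definition tensor_range :: "nat \<Rightarrow> bool_tensor \<Rightarrow> bool_tensor set" where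
  "tensor_range N A = {A \<star>\<^bsub>N\<^esub> X | X. dims X = drop (length (dims A) - N) (dims A)}"

definition is_solution :: "nat \<Rightarrow> bool_tensor \<Rightarrow> bool_tensor \<Rightarrow> bool_tensor \<Rightarrow> bool" where
  "is_solution N A Y Z \<longleftrightarrow>
    dims Z = drop (length (dims A) - N) (dims A) \<and> A \<star>\<^bsub>N\<^esub> Z = Y"

definition idempotent_tensor :: "nat \<Rightarrow> bool_tensor \<Rightarrow> bool" where
  "idempotent_tensor M B \<longleftrightarrow>
    (\<exists>Is. length Is = M \<and> dims B = Is @ Is) \<and> B \<star>\<^bsub>M\<^esub> B = B"

lemma Rep_mk_tensor:
  "Rep_bool_tensor (mk_tensor ds f) = (ds, \<lambda>is. is \<in> multi_indices ds \<and> f is)"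
  unfolding mk_tensor_def by (rule Abs_bool_tensor_inverse) simp

lemma dims_mk_tensor [simp]: "dims (mk_tensor ds f) = ds"
  by (simp add: dims_def Rep_mk_tensor)

lemma entry_mk_tensor [simp]: "entry (mk_tensor ds f) is \<longleftrightarrow> is \<in> multi_indices ds \<and> f is"
  by (simp add: entry_def Rep_mk_tensor)

lemma entry_outside: "entry A is \<Longrightarrow> is \<in> multi_indices (dims A)"
  using Rep_bool_tensor[of A] by (auto simp: entry_def dims_def)

lemma bool_tensor_eqI:
  assumes "dims A = dims B" and "\<And>is. is \<in> multi_indices (dims A) \<Longrightarrow> entry A is = entry B is"
  shows "A = B"
proof -
  have "entry A = entry B"
  proof
    fix "is"
    show "entry A is = entry B is"
      using assms entry_outside[of A "is"] entry_outside[of B "is"] by auto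
  qed
  with assms(1) show ?thesis
    by (metis Rep_bool_tensor_inject dims_def entry_def prod.expand)
qed

lemma length_multi_index: "is \<in> multi_indices ds \<Longrightarrow> length is = length ds"
  by (simp add: multi_indices_def list_all2_lengthD)

lemma multi_indices_append:
  "length is = length ds \<Longrightarrow>
    is @ js \<in> multi_indices (ds @ es) \<longleftrightarrow> is \<in> multi_indices ds \<and> js \<in> multi_indices es"
  by (simp add: multi_indices_def list_all2_append)

lemma dims_einstein_product:
  assumes "dims A = Is @ Js" and "dims B = Js @ Ks" and "length Js = N"
  shows "dims (A \<star>\<^bsub>N\<^esub> B) = Is @ Ks"
  using assms by (simp add: einstein_product_def Let_def)

lemma entry_einstein_product:
  assumes "dims A = Is @ Js" and "dims B = Js @ Ks" and "length Js = N"
    and "i \<in> multi_indices Is" and "k \<in> multi_indices Ks"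
  shows "entry (A \<star>\<^bsub>N\<^esub> B) (i @ k) \<longleftrightarrow> (\<exists>j \<in> multi_indices Js. entry A (i @ j) \<and> entry B (j @ k))"
  using assms length_multi_index[OF assms(4)]
  by (simp add: einstein_product_def Let_def multi_indices_append)

lemma dims_tensor_transpose:
  assumes "dims A = Is @ Js" and "length Is = M"
  shows "dims (tensor_transpose M A) = Js @ Is"
  using assms by (simp add: tensor_transpose_def Let_def)

lemma entry_tensor_transpose:
  assumes "dims A = Is @ Js" and "length Is = M"
    and "i \<in> multi_indices Is" and "j \<in> multi_indices Js"
  shows "entry (tensor_transpose M A) (j @ i) = entry A (i @ j)"
  using assms length_multi_index[OF assms(4)]
  by (simp add: tensor_transpose_def Let_def multi_indices_append)

end

theory Submission
  imports Defs
begin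

text \<open>
  Once the sizes are fixed, Boolean tensors behave like Boolean matrices: the Einstein product is
  associative (\<open>einstein_product_assoc\<close>), transposition reverses it (\<open>tensor_transpose_product\<close>),
  and a tensor is determined by its action on vectors (\<open>bool_tensor_eq_if_same_action\<close>), because
  multiplying by a unit vector extracts a column.

  By the last fact, the equation \<open>A X A = A\<close> says exactly that \<open>A X\<close> fixes every \<open>A v\<close>, that is,
  every element of the range of \<open>A\<close>. By associativity, \<open>A (X y) = y\<close> for all such \<open>y\<close>,
  which is the solvability condition (b).

  For (c), note that the range of \<open>A X\<close> always lies in that of \<open>A\<close>. If \<open>A X\<close> fixes the range of
  \<open>A\<close>, then the two ranges agree, and \<open>A X A X = A X\<close> by right multiplication with \<open>X\<close>.
  Conversely, an idempotent fixes its own range, so if \<open>A X\<close> is idempotent and its range is that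
  of \<open>A\<close>, then it fixes the range of \<open>A\<close>.

  Condition (d) is (c) for the transposed pair: \<open>A X A = A\<close> is equivalent to
  \<open>A\<^sup>T X\<^sup>T A\<^sup>T = A\<^sup>T\<close>, and \<open>A\<^sup>T X\<^sup>T = (X A)\<^sup>T\<close> is idempotent if and only if \<open>X A\<close> is.
\<close>

lemma multi_index_appendE:
  assumes "is \<in> multi_indices (ds @ es)"
  obtains i j where "is = i @ j" "i \<in> multi_indices ds" "j \<in> multi_indices es"
  using assms by (auto simp: multi_indices_def list_all2_append2)

lemma bool_tensor_eqI_append:
  assumes "dims A = Is @ Ks" and "dims B = Is @ Ks"
    and "\<And>i k. i \<in> multi_indices Is \<Longrightarrow> k \<in> multi_indices Ks \<Longrightarrow> entry A (i @ k) = entry B (i @ k)"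
  shows "A = B"
  using assms by (auto intro!: bool_tensor_eqI elim!: multi_index_appendE)

lemma einstein_product_assoc:
  assumes A: "dims A = Is @ Js" and B: "dims B = Js @ Ks" and C: "dims C = Ks @ Ls"
    and N: "length Js = N" and K: "length Ks = K"
  shows "A \<star>\<^bsub>N\<^esub> B \<star>\<^bsub>K\<^esub> C = A \<star>\<^bsub>N\<^esub> (B \<star>\<^bsub>K\<^esub> C)"
proof (rule bool_tensor_eqI_append)
  note AB = dims_einstein_product[OF A B N] and BC = dims_einstein_product[OF B C K]
  show "dims (A \<star>\<^bsub>N\<^esub> B \<star>\<^bsub>K\<^esub> C) = Is @ Ls" by (rule dims_einstein_product[OF AB C K])
  show "dims (A \<star>\<^bsub>N\<^esub> (B \<star>\<^bsub>K\<^esub> C)) = Is @ Ls" by (rule dims_einstein_product[OF A BC N])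
  fix i l assume "i \<in> multi_indices Is" "l \<in> multi_indices Ls"
  then show "entry (A \<star>\<^bsub>N\<^esub> B \<star>\<^bsub>K\<^esub> C) (i @ l) = entry (A \<star>\<^bsub>N\<^esub> (B \<star>\<^bsub>K\<^esub> C)) (i @ l)"
    by (auto simp: entry_einstein_product[OF AB C K] entry_einstein_product[OF A BC N]
        entry_einstein_product[OF A B N] entry_einstein_product[OF B C K])
qed

lemma dims_einstein_product_vector:
  assumes "dims A = Is @ Js" and "dims v = Js" and "length Js = N"
  shows "dims (A \<star>\<^bsub>N\<^esub> v) = Is"
  using dims_einstein_product[of A Is Js v "[]" N] assms by simp

lemma einstein_product_assoc_vector:
  assumes "dims A = Is @ Js" and "dims B = Js @ Ks" and "dims v = Ks"
    and "length Js = N" and "length Ks = K"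
  shows "A \<star>\<^bsub>N\<^esub> B \<star>\<^bsub>K\<^esub> v = A \<star>\<^bsub>N\<^esub> (B \<star>\<^bsub>K\<^esub> v)"
  using einstein_product_assoc[of A Is Js B Ks v "[]"] assms by simp

lemma entry_einstein_product_unit_vector:
  assumes "dims A = Is @ Js" and "length Js = N"
    and "i \<in> multi_indices Is" and "j \<in> multi_indices Js"
  shows "entry (A \<star>\<^bsub>N\<^esub> mk_tensor Js (\<lambda>j'. j' = j)) i = entry A (i @ j)"
  using entry_einstein_product[of A Is Js "mk_tensor Js (\<lambda>j'. j' = j)" "[]" N i "[]"] assms
  by (auto simp: multi_indices_def)

text \<open>
  Unit vectors suffice as test vectors, since they pick out the columns one by one.
\<close>

lemma bool_tensor_eq_if_same_action:
  assumes A: "dims A = Is @ Js" and B: "dims B = Is @ Js" and N: "length Js = N"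
    and action: "\<And>v. dims v = Js \<Longrightarrow> A \<star>\<^bsub>N\<^esub> v = B \<star>\<^bsub>N\<^esub> v"
  shows "A = B"
proof (rule bool_tensor_eqI_append[OF A B])
  fix i j assume "i \<in> multi_indices Is" "j \<in> multi_indices Js"
  then show "entry A (i @ j) = entry B (i @ j)"
    using action[of "mk_tensor Js (\<lambda>j'. j' = j)"]
    by (simp flip: entry_einstein_product_unit_vector[OF A N] entry_einstein_product_unit_vector[OF B N])
qed

lemma tensor_range_eq:
  assumes "dims A = Is @ Js" and "length Js = N"
  shows "tensor_range N A = {A \<star>\<^bsub>N\<^esub> v | v. dims v = Js}"
  using assms by (simp add: tensor_range_def)

lemma idempotent_tensor_iff:
  assumes "dims B = Is @ Is" and "length Is = M"
  shows "idempotent_tensor M B \<longleftrightarrow> B \<star>\<^bsub>M\<^esub> B = B"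
  using assms by (auto simp: idempotent_tensor_def)

text \<open>
  Both sides say that \<open>B (A v) = A v\<close> for all vectors \<open>v\<close>. Taking \<open>A = B\<close> shows that an idempotent
  fixes its own range.
\<close>

lemma einstein_product_eq_iff_fixes_range:
  assumes B: "dims B = Is @ Is" and A: "dims A = Is @ Js"
    and M: "length Is = M" and N: "length Js = N"
  shows "B \<star>\<^bsub>M\<^esub> A = A \<longleftrightarrow> (\<forall>y \<in> tensor_range N A. B \<star>\<^bsub>M\<^esub> y = y)"
proof
  assume "B \<star>\<^bsub>M\<^esub> A = A"
  then show "\<forall>y \<in> tensor_range N A. B \<star>\<^bsub>M\<^esub> y = y"
    by (auto simp: tensor_range_eq[OF A N] simp flip: einstein_product_assoc_vector[OF B A _ M N])
next
  assume "\<forall>y \<in> tensor_range N A. B \<star>\<^bsub>M\<^esub> y = y"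
  then show "B \<star>\<^bsub>M\<^esub> A = A"
    by (intro bool_tensor_eq_if_same_action[OF dims_einstein_product[OF B A M] A N])
      (auto simp: einstein_product_assoc_vector[OF B A _ M N] tensor_range_eq[OF A N])
qed

lemma inner_inverse_iff_solution:
  assumes M: "length Is = M" and N: "length Js = N"
    and A: "dims A = Is @ Js" and X: "dims X = Js @ Is"
  shows "A \<star>\<^bsub>N\<^esub> X \<star>\<^bsub>M\<^esub> A = A \<longleftrightarrow> (\<forall>Y \<in> tensor_range N A. is_solution N A Y (X \<star>\<^bsub>M\<^esub> Y))"
proof -
  have "A \<star>\<^bsub>N\<^esub> X \<star>\<^bsub>M\<^esub> Y = Y \<longleftrightarrow> is_solution N A Y (X \<star>\<^bsub>M\<^esub> Y)" if "Y \<in> tensor_range N A" for Y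
  proof -
    have Y: "dims Y = Is"
      using that dims_einstein_product_vector[OF A _ N] by (auto simp: tensor_range_eq[OF A N])
    show ?thesis
      using dims_einstein_product_vector[OF X Y M] A N
      by (simp add: is_solution_def einstein_product_assoc_vector[OF A X Y N M])
  qed
  then show ?thesis
    using einstein_product_eq_iff_fixes_range[OF dims_einstein_product[OF A X N] A M N] by auto
qed

lemma tensor_range_einstein_product_subset:
  assumes A: "dims A = Is @ Js" and X: "dims X = Js @ Ks" and N: "length Js = N" and K: "length Ks = K"
  shows "tensor_range K (A \<star>\<^bsub>N\<^esub> X) \<subseteq> tensor_range N A"
  using dims_einstein_product_vector[OF X _ K]
  by (auto simp: tensor_range_eq[OF A N] tensor_range_eq[OF dims_einstein_product[OF A X N] K]
      einstein_product_assoc_vector[OF A X _ N K])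

text \<open>
  One inclusion of the ranges always holds; the other comes from reading \<open>(A X) A = A\<close> as a
  factorization of \<open>A\<close> through \<open>A X\<close>. Conversely, the equality of the ranges carries the
  property of being fixed by \<open>A X\<close> from the range of \<open>A X\<close> over to that of \<open>A\<close>.
\<close>

lemma inner_inverse_iff_idempotent_and_range:
  assumes M: "length Is = M" and N: "length Js = N"
    and A: "dims A = Is @ Js" and X: "dims X = Js @ Is"
  shows "A \<star>\<^bsub>N\<^esub> X \<star>\<^bsub>M\<^esub> A = A \<longleftrightarrow>
    idempotent_tensor M (A \<star>\<^bsub>N\<^esub> X) \<and> tensor_range N A = tensor_range M (A \<star>\<^bsub>N\<^esub> X)"
proof -
  note AX = dims_einstein_product[OF A X N]
  show ?thesis
  proof
    assume a: "A \<star>\<^bsub>N\<^esub> X \<star>\<^bsub>M\<^esub> A = A"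
    then have "A \<star>\<^bsub>N\<^esub> X \<star>\<^bsub>M\<^esub> (A \<star>\<^bsub>N\<^esub> X) = A \<star>\<^bsub>N\<^esub> X"
      using einstein_product_assoc[OF AX A X M N] by simp
    moreover have "tensor_range N A \<subseteq> tensor_range M (A \<star>\<^bsub>N\<^esub> X)"
      using tensor_range_einstein_product_subset[OF AX A M N] a by simp
    ultimately show "idempotent_tensor M (A \<star>\<^bsub>N\<^esub> X) \<and> tensor_range N A = tensor_range M (A \<star>\<^bsub>N\<^esub> X)"
      using tensor_range_einstein_product_subset[OF A X N M] by (auto simp: idempotent_tensor_iff[OF AX M])
  next
    \<comment> \<open>\<open>A X\<close> fixes its own range, which is also the range of \<open>A\<close>.\<close>
    assume "idempotent_tensor M (A \<star>\<^bsub>N\<^esub> X) \<and> tensor_range N A = tensor_range M (A \<star>\<^bsub>N\<^esub> X)"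
    then show "A \<star>\<^bsub>N\<^esub> X \<star>\<^bsub>M\<^esub> A = A"
      using einstein_product_eq_iff_fixes_range[OF AX AX M M]
        einstein_product_eq_iff_fixes_range[OF AX A M N]
      by (simp add: idempotent_tensor_iff[OF AX M])
  qed
qed

lemma tensor_transpose_transpose:
  assumes A: "dims A = Is @ Js" and M: "length Is = M" and N: "length Js = N"
  shows "tensor_transpose N (tensor_transpose M A) = A"
proof -
  note At = dims_tensor_transpose[OF A M]
  show ?thesis
    by (rule bool_tensor_eqI_append[OF dims_tensor_transpose[OF At N] A])
      (simp add: entry_tensor_transpose[OF At N] entry_tensor_transpose[OF A M])
qed

lemma tensor_transpose_product:
  assumes A: "dims A = Is @ Js" and B: "dims B = Js @ Ks"
    and M: "length Is = M" and N: "length Js = N"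
  shows "tensor_transpose M (A \<star>\<^bsub>N\<^esub> B) = tensor_transpose N B \<star>\<^bsub>N\<^esub> tensor_transpose M A"
proof -
  note AB = dims_einstein_product[OF A B N]
    and At = dims_tensor_transpose[OF A M] and Bt = dims_tensor_transpose[OF B N]
  show ?thesis
    by (rule bool_tensor_eqI_append[OF dims_tensor_transpose[OF AB M] dims_einstein_product[OF Bt At N]])
      (auto simp: entry_tensor_transpose[OF AB M] entry_einstein_product[OF Bt At N]
        entry_einstein_product[OF A B N] entry_tensor_transpose[OF A M] entry_tensor_transpose[OF B N])
qed

lemma tensor_transpose_inject:
  assumes "dims A = Is @ Js" and "dims B = Is @ Js" and "length Is = M"
  shows "tensor_transpose M A = tensor_transpose M B \<longleftrightarrow> A = B"
  using assms tensor_transpose_transpose by metis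

lemma idempotent_tensor_transpose_iff:
  assumes B: "dims B = Is @ Is" and M: "length Is = M"
  shows "idempotent_tensor M (tensor_transpose M B) \<longleftrightarrow> idempotent_tensor M B"
  using tensor_transpose_inject[OF dims_einstein_product[OF B B M] B M]
  by (simp add: idempotent_tensor_iff[OF B M] idempotent_tensor_iff[OF dims_tensor_transpose[OF B M] M]
      tensor_transpose_product[OF B B M M])

lemma inner_inverse_transpose_iff:
  assumes M: "length Is = M" and N: "length Js = N"
    and A: "dims A = Is @ Js" and X: "dims X = Js @ Is"
  shows "tensor_transpose M A \<star>\<^bsub>M\<^esub> tensor_transpose N X \<star>\<^bsub>N\<^esub> tensor_transpose M A = tensor_transpose M A
    \<longleftrightarrow> A \<star>\<^bsub>N\<^esub> X \<star>\<^bsub>M\<^esub> A = A"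
proof -
  note XA = dims_einstein_product[OF X A M]
  have "tensor_transpose M A \<star>\<^bsub>M\<^esub> tensor_transpose N X \<star>\<^bsub>N\<^esub> tensor_transpose M A
      = tensor_transpose M (A \<star>\<^bsub>N\<^esub> (X \<star>\<^bsub>M\<^esub> A))"
    by (simp add: tensor_transpose_product[OF A XA M N] tensor_transpose_product[OF X A N M])
  then show ?thesis
    using tensor_transpose_inject[OF dims_einstein_product[OF A XA N] A M]
    by (simp add: einstein_product_assoc[OF A X A N M])
qed

theorem theorem3p19:
  fixes A X :: bool_tensor and Is Js :: "nat list" and M N :: nat
  assumes "length Is = M" and "length Js = N"
    and "dims A = Is @ Js" and "dims X = Js @ Is"
  shows "(A \<star>\<^bsub>N\<^esub> X \<star>\<^bsub>M\<^esub> A = A \<longleftrightarrow>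
            (\<forall>Y \<in> tensor_range N A. is_solution N A Y (X \<star>\<^bsub>M\<^esub> Y)))
       \<and> (A \<star>\<^bsub>N\<^esub> X \<star>\<^bsub>M\<^esub> A = A \<longleftrightarrow>
            idempotent_tensor M (A \<star>\<^bsub>N\<^esub> X) \<and>
            tensor_range N A = tensor_range M (A \<star>\<^bsub>N\<^esub> X))
       \<and> (A \<star>\<^bsub>N\<^esub> X \<star>\<^bsub>M\<^esub> A = A \<longleftrightarrow>
            idempotent_tensor N (X \<star>\<^bsub>M\<^esub> A) \<and>
            tensor_range M (tensor_transpose M A) =
            tensor_range N (tensor_transpose M A \<star>\<^bsub>M\<^esub> tensor_transpose N X))"
proof -
  note M = assms(1) and N = assms(2) and A = assms(3) and X = assms(4)
  note At = dims_tensor_transpose[OF A M] and Xt = dims_tensor_transpose[OF X N]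
  have "idempotent_tensor N (tensor_transpose M A \<star>\<^bsub>M\<^esub> tensor_transpose N X)
      \<longleftrightarrow> idempotent_tensor N (X \<star>\<^bsub>M\<^esub> A)"
    using idempotent_tensor_transpose_iff[OF dims_einstein_product[OF X A M] N]
    by (simp add: tensor_transpose_product[OF X A N M])
  then show ?thesis
    using inner_inverse_iff_solution[OF assms] inner_inverse_iff_idempotent_and_range[OF assms]
      inner_inverse_iff_idempotent_and_range[OF N M At Xt] inner_inverse_transpose_iff[OF assms]
    by simp
qed

end
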